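(* For every integer $l$ (and $|q|<1$), $$\sum_{m\ge0}\frac{q^{m^2+m|l|}}{(q;q)_m(q;q)_{m+|l|}}=\frac{1}{(q;q)_\infty}.$$
   Context: $(a;q)_n=\prod_{j=0}^{n-1}(1-aq^j)$ and $(a;q)_\infty=\prod_{j=0}^{\infty}(1-aq^j)$ for $|q|<1$. *)

theory Defs
  imports "HOL-Analysis.Analysis"
begin

definition qpoch :: "complex \<Rightarrow> complex \<Rightarrow> nat \<Rightarrow> complex" where
  "qpoch a q n = (\<Prod>j<n. 1 - a * q ^ j)"

text \<open>The infinite product converges for \<open>norm q < 1\<close>; outside this range the value is
  not meaningful. A product with a vanishing factor has the value \<open>0\<close>.\<close>
definition qpoch_inf :: "complex \<Rightarrow> complex \<Rightarrow> complex" where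
  "qpoch_inf a q = (\<Prod>j. 1 - a * q ^ j)"

end

theory Submission
  imports Defs
begin

text \<open>
  Write \<open>S k\<close> for the sum with \<open>k\<close> in place of \<open>\<bar>l\<bar>\<close>. Up to a telescoping series, the terms of
  \<open>S k - S (k + 1)\<close> are those of \<open>S (k + 1) - S (k + 2)\<close> multiplied by \<open>- q ^ (k + 1)\<close>, so the
  norm of \<open>S k - S (k + 1)\<close> is nondecreasing in \<open>k\<close>. But \<open>S k\<close> tends to \<open>1 / (q; q)\<^sub>\<infinity>\<close>, as only
  the term with \<open>m = 0\<close> survives in the limit; hence the differences vanish and \<open>S\<close> is constantly
  equal to its limit.
\<close>

lemma one_minus_power_Suc_neq_0:
  fixes q :: complex
  assumes "norm q < 1"
  shows "1 - q * q ^ n \<noteq> 0"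
proof
  assume "1 - q * q ^ n = 0"
  hence "q ^ Suc n = 1" by simp
  hence "norm q ^ Suc n = 1" by (metis norm_one norm_power)
  moreover have "norm q ^ Suc n < 1" using assms by (intro power_less_one_iff[THEN iffD2]) auto
  ultimately show False by simp
qed

lemma qpoch_Suc: "qpoch a q (Suc n) = qpoch a q n * (1 - a * q ^ n)"
  by (simp add: qpoch_def)

lemma qpoch_neq_0: "norm q < 1 \<Longrightarrow> qpoch q q n \<noteq> 0"
  unfolding qpoch_def using one_minus_power_Suc_neq_0
  by (simp only: prod_zero_iff finite_lessThan) blast

lemma convergent_prod_qpoch:
  fixes a q :: complex
  assumes "norm q < 1"
  shows "convergent_prod (\<lambda>j. 1 - a * q ^ j)"
proof -
  have "summable (\<lambda>j. norm (a * q ^ j))"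
    unfolding norm_mult norm_power using assms by (intro summable_mult summable_geometric) simp
  hence "summable (\<lambda>j. norm ((1 - a * q ^ j) - 1))" by simp
  thus ?thesis
    by (intro abs_convergent_prod_imp_convergent_prod summable_imp_abs_convergent_prod)
qed

lemma qpoch_tendsto:
  assumes "norm q < 1"
  shows "qpoch a q \<longlonglongrightarrow> qpoch_inf a q"
proof -
  \<comment> \<open>These partial products include the factor at \<open>j = n\<close>, so they are
    \<open>qpoch a q (Suc n)\<close>; the shift is undone at the end.\<close>
  have "(\<lambda>n. \<Prod>j\<le>n. 1 - a * q ^ j) \<longlonglongrightarrow> qpoch_inf a q"
    unfolding qpoch_inf_def by (intro convergent_prod_LIMSEQ convergent_prod_qpoch assms)
  hence "(\<lambda>n. qpoch a q (Suc n)) \<longlonglongrightarrow> qpoch_inf a q"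
    by (simp add: qpoch_def lessThan_Suc_atMost)
  thus ?thesis by (rule LIMSEQ_imp_Suc)
qed

text \<open>A convergent infinite product vanishes only through a zero factor. This makes the
  reciprocals \<open>1 / qpoch q q n\<close> converge, hence stay bounded uniformly in
  \<open>n\<close>.\<close>

lemma qpoch_inf_neq_0: "norm q < 1 \<Longrightarrow> qpoch_inf q q \<noteq> 0"
  unfolding qpoch_inf_def
  by (intro prodinf_nonzero convergent_prod_qpoch one_minus_power_Suc_neq_0)

lemma inverse_qpoch_tendsto:
  "norm q < 1 \<Longrightarrow> (\<lambda>n. 1 / qpoch q q n) \<longlonglongrightarrow> 1 / qpoch_inf q q"
  by (intro tendsto_intros qpoch_tendsto qpoch_inf_neq_0)

lemma inverse_qpoch_bounded:
  assumes "norm q < 1"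
  obtains C where "\<And>n. norm (1 / qpoch q q n) \<le> C"
proof -
  have "Bseq (\<lambda>n. 1 / qpoch q q n)"
    using inverse_qpoch_tendsto[OF assms] by (intro convergent_imp_Bseq convergentI)
  thus ?thesis using that by (meson BseqE)
qed

definition cterm :: "complex \<Rightarrow> nat \<Rightarrow> nat \<Rightarrow> complex" where
  "cterm q k m = q ^ (m\<^sup>2 + m * k) / (qpoch q q m * qpoch q q (m + k))"

text \<open>The factor \<open>1 - q ^ m\<close> makes this vanish at \<open>m = 0\<close>; at
  \<open>Suc m\<close> it cancels the last factor of \<open>qpoch q q (Suc m)\<close>.\<close>

definition ctele :: "complex \<Rightarrow> nat \<Rightarrow> nat \<Rightarrow> complex" where
  "ctele q k m = (1 - q ^ m) * q ^ (m\<^sup>2 + m * k) / (qpoch q q m * qpoch q q (Suc (m + k)))"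

text \<open>Two identities combine. Splitting \<open>1 - q ^ Suc (m + k) - q ^ m\<close> as
  \<open>(1 - q ^ m) - q ^ Suc (m + k)\<close> turns the left-hand side into
  \<open>ctele q k m - q ^ Suc k * cterm q (Suc k) m\<close>, and \<open>ctele q k (Suc m)\<close>
  equals \<open>q ^ Suc k * cterm q (Suc (Suc k)) m\<close>.\<close>

lemma cterm_diff:
  assumes "norm q < 1"
  shows "cterm q k m - cterm q (Suc k) m =
    (ctele q k m - ctele q k (Suc m)) - q ^ Suc k * (cterm q (Suc k) m - cterm q (Suc (Suc k)) m)"
proof -
  define A B x y where "A = qpoch q q m" and "B = qpoch q q (m + k)"
    and "x = q ^ m" and "y = q ^ k"
  define E where "E = q ^ (m\<^sup>2 + m * k)"
  define r s t where "r = 1 - q * x" and "s = 1 - q * (x * y)" and "t = 1 - q * (q * (x * y))"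
  have nz: "A \<noteq> 0" "B \<noteq> 0" "r \<noteq> 0" "s \<noteq> 0" "t \<noteq> 0"
    using qpoch_neq_0[OF assms] one_minus_power_Suc_neq_0[OF assms, of m]
      one_minus_power_Suc_neq_0[OF assms, of "m + k"]
      one_minus_power_Suc_neq_0[OF assms, of "Suc (m + k)"]
    by (auto simp: A_def B_def x_def y_def r_def s_def t_def power_add)
  have Q: "qpoch q q (m + k) = B" "qpoch q q (Suc (m + k)) = B * s"
    "qpoch q q (Suc (Suc (m + k))) = B * s * t"
    "qpoch q q m = A" "qpoch q q (Suc m) = A * r"
    by (simp_all add: qpoch_Suc A_def B_def x_def y_def r_def s_def t_def power_add)
  have P: "q ^ (m\<^sup>2 + m * k) = E" "q ^ (m\<^sup>2 + m * Suc k) = E * x"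
    "q ^ (m\<^sup>2 + m * Suc (Suc k)) = E * x * x" "q ^ ((Suc m)\<^sup>2 + Suc m * k) = E * x * x * q * y"
    by (simp_all add: E_def x_def y_def power2_eq_square power_add ac_simps)
  have X: "q ^ m = x" "q ^ Suc m = q * x" "q ^ Suc k = q * y"
    by (simp_all add: x_def y_def)
  \<comment> \<open>A common denominator for all five terms: the factor \<open>r\<close> of
    \<open>qpoch q q (Suc m)\<close> cancels in \<open>ctele q k (Suc m)\<close>. What remains is a
    polynomial identity in \<open>E\<close>, \<open>x\<close>, \<open>y\<close>,
    \<open>q\<close>.\<close>
  let ?D = "A * B * s * t"
  have "cterm q k m = E * s * t / ?D" "cterm q (Suc k) m = E * x * t / ?D"
    "cterm q (Suc (Suc k)) m = E * x * x / ?D"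
    "ctele q k m = (1 - x) * E * t / ?D" "ctele q k (Suc m) = E * x * x * q * y / ?D"
    unfolding cterm_def ctele_def add_Suc add_Suc_right Q P X r_def[symmetric]
    using nz by (simp_all add: mult.assoc)
  moreover have "E * s * t - E * x * t =
      (1 - x) * E * t - E * x * x * q * y - q * y * (E * x * t - E * x * x)"
    unfolding s_def by (simp add: t_def algebra_simps)
  ultimately show ?thesis
    unfolding X by (simp only: diff_divide_distrib[symmetric] times_divide_eq_right)
qed

text \<open>The geometric majorant behind every estimate below: \<open>i = m\<close> gives
  convergence for fixed \<open>k\<close>, while \<open>i = k + m\<close> gives decay in
  \<open>k\<close> as well.\<close>

lemma norm_power_div_qpoch_le:
  assumes q: "norm q < 1" and C: "\<And>n. norm (1 / qpoch q q n) \<le> C" and "i \<le> e"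
  shows "norm (q ^ e / (qpoch q q m * qpoch q q n)) \<le> C\<^sup>2 * norm q ^ i"
proof -
  have "norm (q ^ e) \<le> norm q ^ i"
    using q \<open>i \<le> e\<close> by (simp add: norm_power power_decreasing)
  with mult_mono[OF C C]
  have "norm (1 / qpoch q q m) * norm (1 / qpoch q q n) * norm (q ^ e) \<le> C * C * norm q ^ i"
    by (rule mult_mono) (simp_all add: order_trans[OF norm_ge_zero C])
  thus ?thesis by (simp add: norm_mult norm_divide power2_eq_square)
qed

lemma le_square_plus: "m \<le> m\<^sup>2 + n" for m n :: nat
  by (simp add: power2_eq_square trans_le_add1)

lemma summable_cterm:
  assumes "norm q < 1"
  shows "summable (cterm q k)"
proof -
  obtain C where C: "\<And>n. norm (1 / qpoch q q n) \<le> C"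
    using inverse_qpoch_bounded[OF assms] by blast
  have "summable (\<lambda>m. C\<^sup>2 * norm q ^ m)"
    using assms by (intro summable_mult summable_geometric) simp
  thus ?thesis
    by (rule summable_comparison_test')
      (simp add: cterm_def norm_power_div_qpoch_le[OF assms C le_square_plus])
qed

lemma ctele_tendsto_0:
  assumes "norm q < 1"
  shows "ctele q k \<longlonglongrightarrow> 0"
proof -
  obtain C where C: "\<And>n. norm (1 / qpoch q q n) \<le> C"
    using inverse_qpoch_bounded[OF assms] by blast
  have pow: "(\<lambda>m. C\<^sup>2 * norm q ^ m) \<longlonglongrightarrow> 0"
    using assms by (intro tendsto_mult_right_zero[OF LIMSEQ_power_zero]) simp
  have "(\<lambda>m. q ^ (m\<^sup>2 + m * k) / (qpoch q q m * qpoch q q (Suc (m + k)))) \<longlonglongrightarrow> 0"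
    by (rule Lim_null_comparison[OF _ pow])
      (simp add: norm_power_div_qpoch_le[OF assms C le_square_plus])
  from tendsto_mult[OF tendsto_diff[OF tendsto_const LIMSEQ_power_zero[OF assms]] this, of 1]
  show ?thesis by (simp add: ctele_def[abs_def])
qed

lemma suminf_cterm_diff:
  assumes "norm q < 1"
  shows "suminf (cterm q k) - suminf (cterm q (Suc k)) =
    - (q ^ Suc k * (suminf (cterm q (Suc k)) - suminf (cterm q (Suc (Suc k)))))"
    (is "?L = ?R")
proof -
  note s = summable_sums[OF summable_cterm[OF assms]]
  \<comment> \<open>Both boundary terms vanish, since \<open>ctele q k 0\<close> contains
    \<open>1 - q ^ 0\<close>; so the telescoping part contributes nothing to the sum.\<close>
  have "(\<lambda>m. ctele q k m - ctele q k (Suc m)) sums (ctele q k 0 - 0)"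
    by (rule telescope_sums') (rule ctele_tendsto_0[OF assms])
  from sums_diff[OF this sums_mult[OF sums_diff[OF s s]]]
  have "(\<lambda>m. cterm q k m - cterm q (Suc k) m) sums ?R"
    unfolding cterm_diff[OF assms, of k] by (simp add: ctele_def)
  with sums_diff[OF s s] show ?thesis by (rule sums_unique2)
qed

lemma suminf_cterm_tendsto:
  assumes "norm q < 1"
  shows "(\<lambda>k. suminf (cterm q k)) \<longlonglongrightarrow> 1 / qpoch_inf q q"
proof -
  obtain C where C: "\<And>n. norm (1 / qpoch q q n) \<le> C"
    using inverse_qpoch_bounded[OF assms] by blast
  have geo: "summable (\<lambda>m. C\<^sup>2 * norm q ^ k * norm q ^ m)" for k
    using assms by (intro summable_mult summable_geometric) simp
  have "norm (suminf (cterm q k) - 1 / qpoch q q k) \<le> C\<^sup>2 / (1 - norm q) * norm q ^ k" for k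
  proof -
    \<comment> \<open>Past the term at \<open>m = 0\<close>, which is
      \<open>1 / qpoch q q k\<close>, each exponent is at least \<open>k + m\<close>. The tail is
      thus a geometric series with \<open>norm q ^ k\<close> in front.\<close>
    have "k + m \<le> (Suc m)\<^sup>2 + Suc m * k" for m
      by (simp add: power2_eq_square)
    hence le: "norm (cterm q k (Suc m)) \<le> C\<^sup>2 * norm q ^ k * norm q ^ m" for m
      unfolding cterm_def mult.assoc power_add[symmetric]
      by (rule norm_power_div_qpoch_le[OF assms C])
    have "suminf (cterm q k) = 1 / qpoch q q k + (\<Sum>m. cterm q k (Suc m))"
      using suminf_split_head[OF summable_cterm[OF assms, of k]]
      by (simp add: cterm_def qpoch_def)
    hence "norm (suminf (cterm q k) - 1 / qpoch q q k) = norm (\<Sum>m. cterm q k (Suc m))"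
      by simp
    also have "\<dots> \<le> (\<Sum>m. C\<^sup>2 * norm q ^ k * norm q ^ m)"
      by (rule norm_suminf_le[OF le geo])
    also have "\<dots> = C\<^sup>2 / (1 - norm q) * norm q ^ k"
      using assms by (simp add: suminf_mult suminf_geometric summable_geometric)
    finally show ?thesis .
  qed
  moreover have "(\<lambda>k. C\<^sup>2 / (1 - norm q) * norm q ^ k) \<longlonglongrightarrow> 0"
    using assms by (intro tendsto_mult_right_zero[OF LIMSEQ_power_zero]) simp
  ultimately have "(\<lambda>k. suminf (cterm q k) - 1 / qpoch q q k) \<longlonglongrightarrow> 0"
    by (rule Lim_null_comparison[OF always_eventually[OF allI]])
  from tendsto_add[OF this inverse_qpoch_tendsto[OF assms]] show ?thesis by simp
qed

lemma suminf_cterm: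
  assumes "norm q < 1"
  shows "suminf (cterm q k) = 1 / qpoch_inf q q"
proof -
  define S where "S k = suminf (cterm q k)" for k
  have lim: "S \<longlonglongrightarrow> 1 / qpoch_inf q q"
    unfolding S_def by (rule suminf_cterm_tendsto[OF assms])
  have "norm (S n - S (Suc n)) \<le> norm (S (Suc n) - S (Suc (Suc n)))" for n
  proof -
    have "norm (S n - S (Suc n)) = norm q ^ Suc n * norm (S (Suc n) - S (Suc (Suc n)))"
      unfolding S_def by (subst suminf_cterm_diff[OF assms])
        (simp only: norm_minus_cancel norm_mult norm_power)
    also have "\<dots> \<le> 1 * norm (S (Suc n) - S (Suc (Suc n)))"
      using assms by (intro mult_right_mono power_le_one) auto
    finally show ?thesis by simp
  qed
  hence inc: "incseq (\<lambda>n. norm (S n - S (Suc n)))" by (rule incseq_SucI)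
  have "(\<lambda>n. norm (S n - S (Suc n))) \<longlonglongrightarrow> 0"
    using tendsto_norm[OF tendsto_diff[OF lim LIMSEQ_Suc[OF lim]]] by simp
  \<comment> \<open>A nondecreasing sequence never exceeds its limit, which is \<open>0\<close> here
    because \<open>S\<close> converges.\<close>
  with inc have "norm (S n - S (Suc n)) \<le> 0" for n by (rule incseq_le)
  hence "S (Suc n) = S n" for n by simp
  hence "S n = S 0" for n by (induction n) simp_all
  hence "S = (\<lambda>_. S k)" by metis
  with lim have "(\<lambda>_. S k) \<longlonglongrightarrow> 1 / qpoch_inf q q" by metis
  thus ?thesis by (simp add: LIMSEQ_const_iff S_def)
qed

theorem theorem4p2:
  fixes q :: complex and l :: int
  assumes "norm q < 1"
  shows "(\<lambda>m. q ^ (m\<^sup>2 + m * nat \<bar>l\<bar>) / (qpoch q q m * qpoch q q (m + nat \<bar>l\<bar>)))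
           sums (1 / qpoch_inf q q)"
  using summable_sums[OF summable_cterm[OF assms, of "nat \<bar>l\<bar>"]]
  unfolding suminf_cterm[OF assms] cterm_def .

end
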